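(* Let $H$ be a realizable 3-uniform hypergraph and let $T$ be a realization of $H$. Let $M$ be a module of $H$. Suppose that $M$ is not a module of $T$, and set $$S_T(M)=\{v\in V(H)\setminus M:\ M \text{ is not a module of } T[M\cup\{v\}]\}.$$ Then the following four assertions hold: 1. $M\cup S_T(M)$ is a module of $T$; 2. $M$ is not a strong module of $H$; 3. $M\cup S_T(M)\subseteq\widetilde{M}^H$; 4. the quotient $H[\widetilde{M}^H]/\Pi(H[\widetilde{M}^H])$ is an empty hypergraph and $|\Pi(H[\widetilde{M}^H])|\geq 3$.
   Context: All structures are finite. A 3-uniform hypergraph $H$ consists of a vertex set $V(H)$ and an edge set $E(H)\subseteq\binom{V(H)}{3}$; it is empty if $E(H)=\emptyset$. For $W\subseteq V(H)$, $H[W]$ is the hypergraph with vertex set $W$ and edge set $\{e\in E(H):e\subseteq W\}$. A tournament $T$ has a vertex set $V(T)$ and an arc set $A(T)$ such that for distinct $v,w\in V(T)$ exactly one of $vw,wv$ belongs to $A(T)$; $T[W]$ denotes the subtournament induced by $W$. A 3-cycle is a tournament on three vertices isomorphic to $(\{0,1,2\},\{01,12,20\})$. The $C_3$-structure $C_3(T)$ of a tournament $T$ is the 3-uniform hypergraph on $V(T)$ whose edges are the 3-element subsets $X$ of $V(T)$ such that $T[X]$ is a 3-cycle. A tournament $T$ with $V(T)=V(H)$ is a realization of $H$ if $H=C_3(T)$; $H$ is realizable if it admits a realization. A subset $M$ of $V(H)$ is a module of the hypergraph $H$ if for each $e\in E(H)$ such that $e\cap M\neq\emptyset$ and $e\setminus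 M\neq\emptyset$, there exists $m\in M$ such that $e\cap M=\{m\}$ and for every $n\in M$, $(e\setminus\{m\})\cup\{n\}\in E(H)$. A subset $M$ of $V(T)$ is a module of the tournament $T$ if for any $x,y\in M$ and $v\in V(T)$, if $xv,vy\in A(T)$, then $v\in M$. A module $M$ of $H$ is strong if for every module $N$ of $H$ with $M\cap N\neq\emptyset$, we have $M\subseteq N$ or $N\subseteq M$. For nonempty $W\subseteq V(H)$, $\widetilde{W}^H$ denotes the intersection of the strong modules of $H$ containing $W$; it is the smallest strong module of $H$ containing $W$. When $|V(H)|\geq 2$, $\Pi(H)$ denotes the set of the strong modules of $H$ distinct from $V(H)$ that are maximal under inclusion among those; it is a partition of $V(H)$. For a partition $P$ of $V(H)$ into modules of $H$, the quotient $H/P$ is the hypergraph with vertex set $P$ such that $\mathcal{E}\subseteq P$ is an edge of $H/P$ iff $|\mathcal{E}|\geq 2$ and there exists $e\in E(H)$ with $\mathcal{E}=\{X\in P:X\cap e\neq\emptyset\}$. *)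

theory Defs
  imports "Graph_Theory.Graph_Theory"
begin

section \<open>Hypergraphs, their modules and quotients\<close>

record 'a hypergraph =
  hverts :: "'a set"
  hedges :: "'a set set"

definition three_uniform :: "'a hypergraph \<Rightarrow> bool" where
  "three_uniform H \<longleftrightarrow>
     finite (hverts H) \<and> hedges H \<subseteq> {e. e \<subseteq> hverts H \<and> card e = 3}"

definition empty_hypergraph :: "'a hypergraph \<Rightarrow> bool" where
  "empty_hypergraph H \<longleftrightarrow> hedges H = {}"

definition hinduce :: "'a hypergraph \<Rightarrow> 'a set \<Rightarrow> 'a hypergraph" where
  "hinduce H W = \<lparr>hverts = W, hedges = {e \<in> hedges H. e \<subseteq> W}\<rparr>"

definition hmodule :: "'a hypergraph \<Rightarrow> 'a set \<Rightarrow> bool" where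
  "hmodule H M \<longleftrightarrow> M \<subseteq> hverts H \<and>
     (\<forall>e\<in>hedges H. e \<inter> M \<noteq> {} \<and> e - M \<noteq> {} \<longrightarrow>
        (\<exists>m\<in>M. e \<inter> M = {m} \<and> (\<forall>n\<in>M. (e - {m}) \<union> {n} \<in> hedges H)))"

definition strong_hmodule :: "'a hypergraph \<Rightarrow> 'a set \<Rightarrow> bool" where
  "strong_hmodule H M \<longleftrightarrow> hmodule H M \<and>
     (\<forall>N. hmodule H N \<and> M \<inter> N \<noteq> {} \<longrightarrow> M \<subseteq> N \<or> N \<subseteq> M)"

definition strong_hull :: "'a hypergraph \<Rightarrow> 'a set \<Rightarrow> 'a set" where
  "strong_hull H W = \<Inter>{N. strong_hmodule H N \<and> W \<subseteq> N}"

text \<open>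
  The next set is a partition of \<^term>\<open>hverts H\<close> only if \<^term>\<open>H\<close> has at least two
  vertices; for a single vertex it degenerates to \<^term>\<open>{{}}\<close>, since the empty set is a
  strong module.
\<close>

definition max_strong_hmodules :: "'a hypergraph \<Rightarrow> 'a set set" where
  "max_strong_hmodules H =
     {X. strong_hmodule H X \<and> X \<noteq> hverts H \<and>
         (\<forall>Y. strong_hmodule H Y \<and> Y \<noteq> hverts H \<and> X \<subseteq> Y \<longrightarrow> Y = X)}"

text \<open>The quotient is meant for partitions \<^term>\<open>P\<close> of \<^term>\<open>hverts H\<close> into modules.\<close>

definition hquotient :: "'a hypergraph \<Rightarrow> 'a set set \<Rightarrow> 'a set hypergraph" where
  "hquotient H P = \<lparr>hverts = P,
     hedges = {F. F \<subseteq> P \<and> card F \<ge> 2 \<and> (\<exists>e\<in>hedges H. F = {X \<in> P. X \<inter> e \<noteq> {}})}\<rparr>"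


section \<open>Tournaments\<close>

text \<open>
  The locale predicate \<^term>\<open>pair_digraph T\<close> says that the arcs of \<^term>\<open>T\<close> are pairs of
  distinct vertices and that \<^term>\<open>T\<close> is finite.
\<close>

definition tournament :: "'a pair_pre_digraph \<Rightarrow> bool" where
  "tournament T \<longleftrightarrow> pair_digraph T \<and>
     (\<forall>v\<in>pverts T. \<forall>w\<in>pverts T. v \<noteq> w \<longrightarrow> ((v, w) \<in> parcs T) \<noteq> ((w, v) \<in> parcs T))"

definition three_cycle :: "('a, 'b) pre_digraph \<Rightarrow> bool" where
  "three_cycle G \<longleftrightarrow>
     digraph_iso G
       (with_proj \<lparr>pverts = {0::nat, 1, 2}, parcs = {(0, 1), (1, 2), (2, 0)}\<rparr>)"

definition C3_structure :: "'a pair_pre_digraph \<Rightarrow> 'a hypergraph" where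
  "C3_structure T = \<lparr>hverts = pverts T,
     hedges = {X. X \<subseteq> pverts T \<and> card X = 3 \<and> three_cycle (with_proj T \<restriction> X)}\<rparr>"

definition realization :: "'a pair_pre_digraph \<Rightarrow> 'a hypergraph \<Rightarrow> bool" where
  "realization T H \<longleftrightarrow> tournament T \<and> pverts T = hverts H \<and> H = C3_structure T"

definition realizable :: "'a hypergraph \<Rightarrow> bool" where
  "realizable H \<longleftrightarrow> (\<exists>T. realization T H)"

definition tmodule :: "('a, 'b) pre_digraph \<Rightarrow> 'a set \<Rightarrow> bool" where
  "tmodule G M \<longleftrightarrow> M \<subseteq> verts G \<and>
     (\<forall>x\<in>M. \<forall>y\<in>M. \<forall>v\<in>verts G. x \<rightarrow>\<^bsub>G\<^esub> v \<and> v \<rightarrow>\<^bsub>G\<^esub> y \<longrightarrow> v \<in> M)"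

definition splitters :: "'a pair_pre_digraph \<Rightarrow> 'a set \<Rightarrow> 'a set" where
  "splitters T M = {v \<in> pverts T - M. \<not> tmodule (with_proj T \<restriction> (M \<union> {v})) M}"

end

theory Submission
  imports Defs
begin

text \<open>
  Each splitter \<open>s\<close> of \<open>M\<close> cuts \<open>M\<close> into the set \<open>A\<close> of its in-neighbours and the set of its
  out-neighbours, and these cuts are nested: \<open>T[M \<union> S]\<close> is a linear sum in which \<open>s\<close> separates
  \<open>A\<close> from \<open>M - A\<close>. The initial segment ending at \<open>s\<close> is a module overlapping \<open>M\<close>, so \<open>M\<close> is not
  strong and every strong module containing \<open>M\<close> contains \<open>s\<close>. The last assertion is a fact about
  hypergraphs. Let \<open>K\<close> be the strong hull of \<open>M \<noteq> K\<close>. A maximal proper module \<open>X \<supseteq> M\<close> of \<open>H[K]\<close> is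
  not strong, so it overlaps a module \<open>N\<close> with \<open>X \<union> N = K\<close>, and then no edge crosses \<open>N\<close>. Hence
  \<open>H[K]\<close> is disconnected, its connected components are its maximal strong modules, and \<open>M\<close> is a
  union of at least two but not all of them.
\<close>

section \<open>Modules of 3-uniform hypergraphs\<close>

lemma three_uniformD:
  assumes "three_uniform H" "e \<in> hedges H"
  shows "e \<subseteq> hverts H" "card e = 3" "e \<noteq> {}"
  using assms unfolding three_uniform_def by auto

lemma three_uniform_hinduce:
  assumes "three_uniform H" "W \<subseteq> hverts H"
  shows "three_uniform (hinduce H W)"
  using assms finite_subset unfolding three_uniform_def hinduce_def by auto

lemma hmodule_subset: "hmodule H M \<Longrightarrow> M \<subseteq> hverts H"
  unfolding hmodule_def by blast

lemma hmoduleE: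
  assumes "hmodule H M" "e \<in> hedges H" "e \<inter> M \<noteq> {}" "\<not> e \<subseteq> M"
  obtains m where "m \<in> M" "e \<inter> M = {m}" "\<forall>n\<in>M. insert n (e - {m}) \<in> hedges H"
proof -
  have "e - M \<noteq> {}"
    using assms(4) by blast
  then obtain m where "m \<in> M" "e \<inter> M = {m}" "\<forall>n\<in>M. (e - {m}) \<union> {n} \<in> hedges H"
    using assms(1-3) unfolding hmodule_def by meson
  then show thesis
    using that[of m] by simp
qed

text \<open>Replacing the vertex that an edge has in one module by a common vertex of the two
  modules gives an edge that crosses the other module. Both module conditions then act on the same
  remainder of the edge. The auxiliary fact is one-sided so that \<open>M\<close> and
  \<open>N\<close> can exchange roles.\<close>

lemma hmodule_Un:
  assumes M: "hmodule H M" and N: "hmodule H N" and meet: "M \<inter> N \<noteq> {}"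
  shows "hmodule H (M \<union> N)"
proof -
  have main: "\<exists>m\<in>A \<union> B. e \<inter> (A \<union> B) = {m} \<and> (\<forall>n\<in>A \<union> B. (e - {m}) \<union> {n} \<in> hedges H)"
    if A: "hmodule H A" and B: "hmodule H B" and p: "p \<in> A" "p \<in> B"
      and e: "e \<in> hedges H" "e \<inter> A \<noteq> {}" "\<not> e \<subseteq> A \<union> B" for A B e p
  proof -
    have "\<not> e \<subseteq> A"
      using e(3) by blast
    then obtain m where m: "m \<in> A" "e \<inter> A = {m}"
      "\<forall>n\<in>A. insert n (e - {m}) \<in> hedges H"
      by (rule hmoduleE[OF A e(1,2)])
    let ?e = "insert p (e - {m})"
    have "?e \<inter> B \<noteq> {}" "\<not> ?e \<subseteq> B"
      using e(3) m(1) p(2) by blast+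
    then obtain k where k: "k \<in> B" "?e \<inter> B = {k}"
      "\<forall>n\<in>B. insert n (?e - {k}) \<in> hedges H"
      by (rule hmoduleE[OF B bspec[OF m(3) p(1)]])
    have "p \<in> ?e \<inter> B"
      using p(2) by simp
    then have kp: "k = p"
      using k(2) by simp
    \<comment> \<open>Hence \<open>p\<close> is never in \<open>e - {m}\<close>, and
      \<open>p\<close> was the only candidate for a vertex of \<open>e - {m}\<close> in
      \<open>B\<close>.\<close>
    have "p = m" if "p \<in> e"
      using that p(1) m(2) by blast
    moreover have "(e - {m}) \<inter> B \<subseteq> {p}"
      using k(2) kp by blast
    ultimately have no_B: "(e - {m}) \<inter> B = {}"
      by blast
    have "?e - {p} = e - {m}"
      using no_B p by blast
    then have "insert n (e - {m}) \<in> hedges H" if "n \<in> A \<union> B" for n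
      using that m(3) k(3) kp by auto
    moreover have "e \<inter> (A \<union> B) = {m}"
      using no_B m by blast
    ultimately show ?thesis
      using m(1) by auto
  qed
  obtain p where p: "p \<in> M" "p \<in> N"
    using meet by blast
  show ?thesis
    unfolding hmodule_def
  proof (intro conjI ballI impI)
    show "M \<union> N \<subseteq> hverts H"
      using hmodule_subset[OF M] hmodule_subset[OF N] by simp
  next
    fix e assume "e \<in> hedges H" "e \<inter> (M \<union> N) \<noteq> {} \<and> e - (M \<union> N) \<noteq> {}"
    then have e: "e \<in> hedges H" "e \<inter> M \<noteq> {} \<or> e \<inter> N \<noteq> {}" "\<not> e \<subseteq> M \<union> N"
      by blast+
    from e(2) show "\<exists>m\<in>M \<union> N. e \<inter> (M \<union> N) = {m} \<and> (\<forall>n\<in>M \<union> N. (e - {m}) \<union> {n} \<in> hedges H)"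
    proof
      assume "e \<inter> M \<noteq> {}"
      then show ?thesis
        using main[OF M N p e(1)] e(3) by blast
    next
      assume "e \<inter> N \<noteq> {}"
      then show ?thesis
        using main[OF N M p(2,1) e(1)] e(3) unfolding Un_commute[of N M] by blast
    qed
  qed
qed

section \<open>Strong modules and the strong hull\<close>

lemma strong_hmoduleD:
  assumes "strong_hmodule H M"
  shows "hmodule H M"
    and "hmodule H N \<Longrightarrow> M \<inter> N \<noteq> {} \<Longrightarrow> M \<subseteq> N \<or> N \<subseteq> M"
  using assms unfolding strong_hmodule_def by blast+

lemma strong_hmodule_hverts: "three_uniform H \<Longrightarrow> strong_hmodule H (hverts H)"
  unfolding strong_hmodule_def hmodule_def three_uniform_def by blast

lemma strong_hull_least: "strong_hmodule H N \<Longrightarrow> W \<subseteq> N \<Longrightarrow> strong_hull H W \<subseteq> N"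
  unfolding strong_hull_def by blast

lemma subset_strong_hull: "W \<subseteq> strong_hull H W"
  unfolding strong_hull_def by blast

text \<open>The strong modules containing the nonempty \<open>W\<close> all meet, so any two are
  comparable. A minimal member of this finite family is therefore its least member and equals the
  intersection.\<close>

lemma strong_hmodule_strong_hull:
  assumes H: "three_uniform H" and W: "W \<noteq> {}" "W \<subseteq> hverts H"
  shows "strong_hmodule H (strong_hull H W)"
proof -
  let ?\<F> = "{N. strong_hmodule H N \<and> W \<subseteq> N}"
  have sub: "?\<F> \<subseteq> Pow (hverts H)"
    unfolding strong_hmodule_def by (auto dest: hmodule_subset)
  have "finite (Pow (hverts H))"
    using H unfolding three_uniform_def by simp
  then have fin: "finite ?\<F>"
    using sub by (rule rev_finite_subset)
  have "hverts H \<in> ?\<F>"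
    using strong_hmodule_hverts[OF H] W by blast
  then obtain K where K: "K \<in> ?\<F>" and min: "\<And>N. N \<in> ?\<F> \<Longrightarrow> N \<subseteq> K \<Longrightarrow> K = N"
    using finite_has_minimal[OF fin] by (metis (no_types, lifting) empty_iff)
  have "K \<subseteq> N" if N: "N \<in> ?\<F>" for N
  proof -
    have "K \<inter> N \<noteq> {}"
      using K N W by blast
    then consider "K \<subseteq> N" | "N \<subseteq> K"
      using K N unfolding strong_hmodule_def by blast
    then show ?thesis
      using min N by cases blast+
  qed
  then have "strong_hull H W = K"
    unfolding strong_hull_def using K by blast
  then show ?thesis
    using K by simp
qed

text \<open>The induced hypergraph loses only edges that leave \<open>K\<close>. Such an edge, if it
  meets \<open>X\<close>, has exactly one vertex in \<open>K\<close>, and the module condition of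
  \<open>K\<close> already allows replacing it by any vertex of \<open>X\<close>.\<close>

lemma hmodule_hinduce_iff:
  assumes K: "hmodule H K" and "X \<subseteq> K"
  shows "hmodule (hinduce H K) X \<longleftrightarrow> hmodule H X"
proof
  assume X: "hmodule (hinduce H K) X"
  have "\<exists>m\<in>X. e \<inter> X = {m} \<and> (\<forall>n\<in>X. (e - {m}) \<union> {n} \<in> hedges H)"
    if e: "e \<in> hedges H" "e \<inter> X \<noteq> {}" "e - X \<noteq> {}" for e
  proof (cases "e \<subseteq> K")
    case True
    then have "e \<in> hedges (hinduce H K)"
      using e by (simp add: hinduce_def)
    moreover have "\<not> e \<subseteq> X"
      using e by blast
    ultimately obtain m where m: "m \<in> X" "e \<inter> X = {m}"
      "\<forall>n\<in>X. insert n (e - {m}) \<in> hedges (hinduce H K)"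
      using hmoduleE[OF X _ e(2)] by metis
    have "(e - {m}) \<union> {n} \<in> hedges H" if "n \<in> X" for n
      using bspec[OF m(3) that] by (simp add: hinduce_def)
    then show ?thesis
      using m(1,2) by blast
  next
    case False
    have "e \<inter> K \<noteq> {}"
      using e(2) \<open>X \<subseteq> K\<close> by blast
    then obtain m where m: "m \<in> K" "e \<inter> K = {m}" "\<forall>n\<in>K. insert n (e - {m}) \<in> hedges H"
      using hmoduleE[OF K e(1) _ False] by metis
    have "e \<inter> X \<subseteq> {m}"
      using m(2) \<open>X \<subseteq> K\<close> by blast
    then have "e \<inter> X = {m}" "m \<in> X"
      using e(2) by blast+
    moreover have "(e - {m}) \<union> {n} \<in> hedges H" if "n \<in> X" for n
      using m(3) that \<open>X \<subseteq> K\<close> by auto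
    ultimately show ?thesis
      by blast
  qed
  then show "hmodule H X"
    using hmodule_subset[OF K] \<open>X \<subseteq> K\<close> unfolding hmodule_def by blast
next
  assume X: "hmodule H X"
  have "\<exists>m\<in>X. e \<inter> X = {m} \<and> (\<forall>n\<in>X. (e - {m}) \<union> {n} \<in> hedges (hinduce H K))"
    if e: "e \<in> hedges (hinduce H K)" "e \<inter> X \<noteq> {}" "e - X \<noteq> {}" for e
  proof -
    have eH: "e \<in> hedges H" "e \<subseteq> K" "\<not> e \<subseteq> X"
      using e by (auto simp: hinduce_def)
    obtain m where m: "m \<in> X" "e \<inter> X = {m}" "\<forall>n\<in>X. insert n (e - {m}) \<in> hedges H"
      by (rule hmoduleE[OF X eH(1) e(2) eH(3)])
    have "(e - {m}) \<union> {n} \<in> hedges (hinduce H K)" if "n \<in> X" for n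
      using bspec[OF m(3) that] that eH(2) \<open>X \<subseteq> K\<close> by (auto simp: hinduce_def)
    then show ?thesis
      using m(1,2) by blast
  qed
  then show "hmodule (hinduce H K) X"
    using \<open>X \<subseteq> K\<close> unfolding hmodule_def hinduce_def by auto
qed

lemma hmodule_hinduce:
  assumes "hmodule H N" "hmodule H K" "N \<subseteq> K"
  shows "hmodule (hinduce H K) N"
  using assms hmodule_hinduce_iff by blast

text \<open>A module of \<open>H\<close> that meets \<open>X\<close> also meets the strong module
  \<open>K\<close>. So it contains \<open>K\<close>, or it lies inside \<open>K\<close>, where the
  strength of \<open>X\<close> in the induced hypergraph applies.\<close>

lemma strong_hmodule_of_hinduce:
  assumes K: "strong_hmodule H K" and X: "strong_hmodule (hinduce H K) X"
  shows "strong_hmodule H X"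
proof -
  have KM: "hmodule H K"
    using K unfolding strong_hmodule_def by blast
  have XK: "X \<subseteq> K"
    using X hmodule_subset unfolding strong_hmodule_def hinduce_def by fastforce
  have XH: "hmodule H X"
    using X hmodule_hinduce_iff[OF KM XK] unfolding strong_hmodule_def by blast
  have "X \<subseteq> N \<or> N \<subseteq> X" if N: "hmodule H N" "X \<inter> N \<noteq> {}" for N
  proof -
    have "K \<inter> N \<noteq> {}"
      using N XK by blast
    then consider "K \<subseteq> N" | "N \<subseteq> K"
      using strong_hmoduleD(2)[OF K N(1)] by blast
    then show ?thesis
    proof cases
      case 1
      then show ?thesis
        using XK by blast
    next
      case 2
      then show ?thesis
        using strong_hmoduleD(2)[OF X hmodule_hinduce[OF N(1) KM]] N(2) by blast
    qed
  qed
  with XH show ?thesis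
    unfolding strong_hmodule_def by blast
qed

section \<open>Connected components\<close>

text \<open>In a 3-uniform hypergraph these are the unions of connected components, the empty union
  included.\<close>

definition edge_closed :: "'a hypergraph \<Rightarrow> 'a set \<Rightarrow> bool" where
  "edge_closed H U \<longleftrightarrow> U \<subseteq> hverts H \<and> (\<forall>e\<in>hedges H. e \<inter> U \<noteq> {} \<longrightarrow> e \<subseteq> U)"

text \<open>The connected component of \<open>v\<close>, obtained as a least closed set instead of
  through paths. For \<open>v\<close> outside \<open>hverts H\<close> the family is empty and the
  value is \<open>UNIV\<close>, hence the vertex hypotheses in the lemmas that follow.\<close>

definition hcomp :: "'a hypergraph \<Rightarrow> 'a \<Rightarrow> 'a set" where
  "hcomp H v = \<Inter>{U. edge_closed H U \<and> v \<in> U}"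

lemma edge_closedD: "edge_closed H U \<Longrightarrow> e \<in> hedges H \<Longrightarrow> e \<inter> U \<noteq> {} \<Longrightarrow> e \<subseteq> U"
  unfolding edge_closed_def by blast

lemma edge_closed_hmodule: "edge_closed H U \<Longrightarrow> hmodule H U"
  unfolding edge_closed_def hmodule_def by blast

lemma edge_closed_Compl: "three_uniform H \<Longrightarrow> edge_closed H U \<Longrightarrow> edge_closed H (hverts H - U)"
  unfolding edge_closed_def three_uniform_def by blast

lemma edge_closed_hverts: "three_uniform H \<Longrightarrow> edge_closed H (hverts H)"
  unfolding edge_closed_def three_uniform_def by blast

lemma edge_closed_hcomp:
  assumes "three_uniform H" "v \<in> hverts H"
  shows "edge_closed H (hcomp H v)"
proof -
  have "hcomp H v \<subseteq> hverts H"
    using edge_closed_hverts[OF assms(1)] assms(2) unfolding hcomp_def by blast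
  then show ?thesis
    unfolding edge_closed_def hcomp_def by blast
qed

lemma hcomp_self: "v \<in> hcomp H v"
  unfolding hcomp_def by blast

lemma hcomp_least: "edge_closed H U \<Longrightarrow> v \<in> U \<Longrightarrow> hcomp H v \<subseteq> U"
  unfolding hcomp_def by blast

text \<open>Components are minimal: a closed set missing \<open>v\<close> has a closed complement
  containing \<open>v\<close>, and that complement contains the whole component.\<close>

lemma edge_closed_subset_hcomp:
  assumes H: "three_uniform H" and v: "v \<in> hverts H"
    and U: "edge_closed H U" "U \<subseteq> hcomp H v" "U \<noteq> {}"
  shows "U = hcomp H v"
proof (cases "v \<in> U")
  case True
  then show ?thesis
    using hcomp_least[OF U(1)] U(2) by blast
next
  case False
  then have "hcomp H v \<subseteq> hverts H - U"
    using hcomp_least[OF edge_closed_Compl[OF H U(1)]] v by blast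
  then show ?thesis
    using U by blast
qed

text \<open>Let a module \<open>N\<close> meet the component and also have a vertex \<open>n\<close>
  outside it. An edge of the component crossing \<open>N\<close> could exchange its vertex in
  \<open>N\<close> for \<open>n\<close> and would then connect the component to \<open>n\<close>. So
  \<open>?C \<inter> N\<close> is closed, and minimality makes it all of \<open>?C\<close>.\<close>

lemma strong_hmodule_hcomp:
  assumes H: "three_uniform H" and v: "v \<in> hverts H"
  shows "strong_hmodule H (hcomp H v)"
proof -
  let ?C = "hcomp H v"
  have C: "edge_closed H ?C"
    using edge_closed_hcomp[OF H v] .
  have "?C \<subseteq> N" if N: "hmodule H N" "?C \<inter> N \<noteq> {}" "\<not> N \<subseteq> ?C" for N
  proof -
    obtain n where n: "n \<in> N" "n \<notin> ?C"
      using N(3) by blast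
    have "e \<subseteq> ?C \<inter> N" if e: "e \<in> hedges H" "e \<inter> (?C \<inter> N) \<noteq> {}" for e
    proof (rule ccontr)
      assume not_sub: "\<not> e \<subseteq> ?C \<inter> N"
      have eC: "e \<subseteq> ?C"
        using edge_closedD[OF C e(1)] e(2) by blast
      then have "\<not> e \<subseteq> N"
        using not_sub by blast
      moreover have "e \<inter> N \<noteq> {}"
        using e(2) by blast
      ultimately obtain m where m: "e \<inter> N = {m}"
        "\<forall>k\<in>N. insert k (e - {m}) \<in> hedges H"
        using hmoduleE[OF N(1) e(1)] by metis
      have "e - {m} \<noteq> {}"
        using m(1) \<open>\<not> e \<subseteq> N\<close> by blast
      then have "insert n (e - {m}) \<inter> ?C \<noteq> {}"
        using eC by blast
      then have "insert n (e - {m}) \<subseteq> ?C"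
        by (rule edge_closedD[OF C bspec[OF m(2) n(1)]])
      then show False
        using n(2) by blast
    qed
    then have "edge_closed H (?C \<inter> N)"
      using C unfolding edge_closed_def by blast
    then show ?thesis
      using edge_closed_subset_hcomp[OF H v] N(2) by blast
  qed
  then show ?thesis
    using edge_closed_hmodule[OF C] unfolding strong_hmodule_def by blast
qed

text \<open>A component and its complement are both modules. A strong module meeting both is
  contained in neither, so it contains both and is everything.\<close>

lemma strong_hmodule_subset_hcomp:
  assumes H: "three_uniform H" and X: "strong_hmodule H X" "X \<noteq> hverts H" and x: "x \<in> X"
  shows "X \<subseteq> hcomp H x"
proof
  fix y assume y: "y \<in> X"
  have XV: "X \<subseteq> hverts H"
    using X hmodule_subset unfolding strong_hmodule_def by blast
  have C: "edge_closed H (hcomp H x)"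
    using edge_closed_hcomp[OF H] XV x by blast
  show "y \<in> hcomp H x"
  proof (rule ccontr)
    assume ny: "y \<notin> hcomp H x"
    have "hcomp H x \<subseteq> X"
      using strong_hmoduleD(2)[OF X(1) edge_closed_hmodule[OF C]] x y ny hcomp_self[of x H]
      by blast
    moreover have "hverts H - hcomp H x \<subseteq> X"
      using strong_hmoduleD(2)[OF X(1) edge_closed_hmodule[OF edge_closed_Compl[OF H C]]]
        x y ny XV hcomp_self[of x H] by blast
    ultimately show False
      using X(2) XV by blast
  qed
qed

section \<open>Overlapping modules and disconnectedness\<close>

lemma edge_closed_of_overlapping:
  assumes H: "three_uniform H" and X: "hmodule H X" and N: "hmodule H N"
    and cover: "X \<union> N = hverts H" and overlap: "\<not> N \<subseteq> X"
  shows "edge_closed H N"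
proof -
  have "e \<subseteq> N" if e: "e \<in> hedges H" "e \<inter> N \<noteq> {}" for e
  proof (rule ccontr)
    assume "\<not> e \<subseteq> N"
    then obtain m where m: "m \<in> N" "e \<inter> N = {m}"
      "\<forall>k\<in>N. insert k (e - {m}) \<in> hedges H"
      by (rule hmoduleE[OF N e])
    obtain n where n: "n \<in> N" "n \<notin> X"
      using overlap by blast
    \<comment> \<open>Since \<open>X\<close> and \<open>N\<close> cover everything, the two vertices
      of \<open>e\<close> outside \<open>N\<close> lie in \<open>X\<close>, while \<open>n\<close>
      does not. This edge would cross the module \<open>X\<close> in two vertices.\<close>
    let ?e = "insert n (e - {m})"
    have sub: "e - {m} \<subseteq> X"
      using m three_uniformD(1)[OF H e(1)] cover by blast
    have "m \<in> e"
      using m by blast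
    then have two: "card (e - {m}) = 2"
      using three_uniformD(2)[OF H e(1)] by simp
    then have "e - {m} \<noteq> {}"
      by fastforce
    then have "?e \<inter> X \<noteq> {}" "\<not> ?e \<subseteq> X"
      using sub n(2) by blast+
    then obtain k where k: "?e \<inter> X = {k}"
      using hmoduleE[OF X bspec[OF m(3) n(1)]] by metis
    have "?e \<inter> X = e - {m}"
      using sub n by blast
    then have "e - {m} = {k}"
      using k by metis
    then show False
      using two by simp
  qed
  then show ?thesis
    using hmodule_subset[OF N] unfolding edge_closed_def by blast
qed

text \<open>The assumption \<open>conn\<close> says that \<open>H\<close> is connected. If
  \<open>N\<close> overlaps \<open>X\<close>, then \<open>X \<union> N\<close> is a module larger
  than \<open>X\<close>, hence everything by maximality, and the previous lemma makes
  \<open>N\<close> a nontrivial closed set.\<close>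

lemma maximal_hmodule_strong:
  assumes H: "three_uniform H" and X: "hmodule H X"
    and max: "\<And>Y. hmodule H Y \<Longrightarrow> Y \<noteq> hverts H \<Longrightarrow> X \<subseteq> Y \<Longrightarrow> Y = X"
    and conn: "\<And>U. edge_closed H U \<Longrightarrow> U = {} \<or> U = hverts H"
  shows "strong_hmodule H X"
proof -
  have "X \<subseteq> N \<or> N \<subseteq> X" if N: "hmodule H N" "X \<inter> N \<noteq> {}" for N
  proof (rule ccontr)
    assume no: "\<not> (X \<subseteq> N \<or> N \<subseteq> X)"
    have "X \<union> N = hverts H"
      using max[OF hmodule_Un[OF X N]] no by blast
    then have "edge_closed H N"
      using edge_closed_of_overlapping[OF H X N(1)] no by blast
    then show False
      using conn N(2) no hmodule_subset[OF X] by blast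
  qed
  then show ?thesis
    using X unfolding strong_hmodule_def by blast
qed

text \<open>If \<open>H\<close> were connected, a maximal proper module containing \<open>M\<close>
  would be strong, against \<open>hull\<close>, which says that the strong hull of \<open>M\<close>
  is everything.\<close>

lemma ex_nontrivial_edge_closed:
  assumes H: "three_uniform H" and M: "hmodule H M" "M \<noteq> hverts H"
    and hull: "\<And>X. strong_hmodule H X \<Longrightarrow> M \<subseteq> X \<Longrightarrow> X = hverts H"
  shows "\<exists>U. edge_closed H U \<and> U \<noteq> {} \<and> U \<noteq> hverts H"
proof (rule ccontr)
  assume *: "\<not> ?thesis"
  let ?\<F> = "{X. hmodule H X \<and> X \<noteq> hverts H \<and> M \<subseteq> X}"
  have sub: "?\<F> \<subseteq> Pow (hverts H)"
    by (auto dest: hmodule_subset)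
  have "finite (Pow (hverts H))"
    using H unfolding three_uniform_def by simp
  then have fin: "finite ?\<F>"
    using sub by (rule rev_finite_subset)
  have "M \<in> ?\<F>"
    using M by blast
  then obtain X where X: "X \<in> ?\<F>" and max: "\<And>Y. Y \<in> ?\<F> \<Longrightarrow> X \<subseteq> Y \<Longrightarrow> X = Y"
    using finite_has_maximal[OF fin] by (metis (no_types, lifting) empty_iff)
  have "Y = X" if "hmodule H Y" "Y \<noteq> hverts H" "X \<subseteq> Y" for Y
    using max[of Y] X that by blast
  then have "strong_hmodule H X"
    using maximal_hmodule_strong[OF H, of X] X * by blast
  then show False
    using hull X by blast
qed

text \<open>The set \<open>U\<close> witnesses that \<open>H\<close> is disconnected. Components are
  then proper strong modules, and every nonempty proper strong module lies inside one of
  them.\<close>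

lemma max_strong_hmodules_eq_hcomp:
  assumes H: "three_uniform H"
    and U: "edge_closed H U" "U \<noteq> {}" "U \<noteq> hverts H"
  shows "max_strong_hmodules H = hcomp H ` hverts H"
proof -
  have proper: "hcomp H v \<noteq> hverts H" if v: "v \<in> hverts H" for v
  proof (cases "v \<in> U")
    case True
    then show ?thesis
      using hcomp_least[OF U(1)] U unfolding edge_closed_def by blast
  next
    case False
    then show ?thesis
      using hcomp_least[OF edge_closed_Compl[OF H U(1)]] v U unfolding edge_closed_def by blast
  qed
  show ?thesis
  proof (intro set_eqI iffI)
    fix X assume "X \<in> max_strong_hmodules H"
    then have X: "strong_hmodule H X" "X \<noteq> hverts H"
      and max: "\<And>Y. strong_hmodule H Y \<Longrightarrow> Y \<noteq> hverts H \<Longrightarrow> X \<subseteq> Y \<Longrightarrow> Y = X"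
      unfolding max_strong_hmodules_def by auto
    have XV: "X \<subseteq> hverts H"
      using X hmodule_subset unfolding strong_hmodule_def by blast
    \<comment> \<open>The empty set is also a strong module; it is not maximal because a component
      is a larger proper one.\<close>
    have "X \<noteq> {}"
    proof
      assume "X = {}"
      obtain u where u: "u \<in> hverts H"
        using U unfolding edge_closed_def by blast
      then have "hcomp H u = {}"
        using max[OF strong_hmodule_hcomp[OF H u] proper[OF u]] \<open>X = {}\<close> by blast
      then show False
        using hcomp_self[of u H] by simp
    qed
    then obtain x where x: "x \<in> X"
      by blast
    with XV have xV: "x \<in> hverts H"
      by blast
    have "hcomp H x = X"
      by (rule max[OF strong_hmodule_hcomp[OF H xV] proper[OF xV]
            strong_hmodule_subset_hcomp[OF H X x]])
    then show "X \<in> hcomp H ` hverts H"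
      using xV by blast
  next
    fix X assume "X \<in> hcomp H ` hverts H"
    then obtain v where v: "v \<in> hverts H" "X = hcomp H v"
      by blast
    have "Y = X" if "strong_hmodule H Y" "Y \<noteq> hverts H" "X \<subseteq> Y" for Y
      using strong_hmodule_subset_hcomp[OF H that(1,2)] that(3) hcomp_self[of v H] v(2) by blast
    then show "X \<in> max_strong_hmodules H"
      using strong_hmodule_hcomp[OF H v(1)] proper[OF v(1)] v(2)
      unfolding max_strong_hmodules_def by blast
  qed
qed

lemma hcomp_eq:
  assumes "three_uniform H" "v \<in> hverts H" "z \<in> hcomp H v"
  shows "hcomp H z = hcomp H v"
proof -
  have C: "edge_closed H (hcomp H v)"
    by (rule edge_closed_hcomp[OF assms(1,2)])
  then have "z \<in> hverts H"
    using assms(3) unfolding edge_closed_def by blast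
  then have "edge_closed H (hcomp H z)"
    by (rule edge_closed_hcomp[OF assms(1)])
  then show ?thesis
    using edge_closed_subset_hcomp[OF assms(1,2)] hcomp_least[OF C assms(3)] hcomp_self[of z H]
    by blast
qed

text \<open>Each edge lies inside a single component, so its trace on the partition has one element,
  below the two demanded of a quotient edge.\<close>

lemma empty_hquotient_hcomp:
  assumes H: "three_uniform H"
  shows "empty_hypergraph (hquotient H (hcomp H ` hverts H))"
proof -
  have False if F: "card F \<ge> 2" "e \<in> hedges H" "F = {X \<in> hcomp H ` hverts H. X \<inter> e \<noteq> {}}" for F e
  proof -
    obtain z where z: "z \<in> e"
      using three_uniformD(3)[OF H F(2)] by blast
    have "X = hcomp H z" if X: "X \<in> F" for X
    proof -
      obtain v where v: "v \<in> hverts H" "X = hcomp H v" "X \<inter> e \<noteq> {}"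
        using X unfolding F(3) by auto
      then have "e \<subseteq> X"
        using edge_closedD[OF edge_closed_hcomp[OF H v(1)] F(2)] by blast
      then show ?thesis
        using hcomp_eq[OF H v(1)] z v(2) by blast
    qed
    then have "card F \<le> card {hcomp H z}"
      by (intro card_mono) auto
    then show False
      using F(1) by simp
  qed
  then show ?thesis
    unfolding empty_hypergraph_def hquotient_def by auto
qed

text \<open>Components are strong, so one that meets \<open>M\<close> is comparable with
  \<open>M\<close> and, by \<open>big\<close>, is contained in it. Two components inside
  \<open>M\<close> and one outside make three.\<close>

lemma card_hcomp_ge_3:
  assumes H: "three_uniform H" and M: "hmodule H M" "M \<noteq> {}" "M \<noteq> hverts H"
    and big: "\<And>v. v \<in> hverts H \<Longrightarrow> \<not> M \<subseteq> hcomp H v"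
  shows "card (hcomp H ` hverts H) \<ge> 3"
proof -
  have MV: "M \<subseteq> hverts H"
    using hmodule_subset[OF M(1)] .
  obtain x where x: "x \<in> M"
    using M(2) by blast
  obtain y where y: "y \<in> M" "y \<notin> hcomp H x"
    using big[of x] x MV by blast
  obtain z where z: "z \<in> hverts H" "z \<notin> M"
    using M(3) MV by blast
  have sub: "hcomp H v \<subseteq> M" if v: "v \<in> M" for v
  proof -
    have "v \<in> hverts H" "hcomp H v \<inter> M \<noteq> {}"
      using v MV hcomp_self[of v H] by blast+
    then show ?thesis
      using strong_hmoduleD(2)[OF strong_hmodule_hcomp[OF H] M(1)] big by metis
  qed
  have "hcomp H x \<noteq> hcomp H y" "hcomp H x \<noteq> hcomp H z" "hcomp H y \<noteq> hcomp H z"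
    using y z sub[OF x] sub[OF y(1)] hcomp_self[of y H] hcomp_self[of z H] by blast+
  then have "card {hcomp H x, hcomp H y, hcomp H z} = 3"
    by simp
  moreover have "finite (hcomp H ` hverts H)"
    using H unfolding three_uniform_def by simp
  moreover have "{hcomp H x, hcomp H y, hcomp H z} \<subseteq> hcomp H ` hverts H"
    using x y z MV by blast
  ultimately show ?thesis
    using card_mono by metis
qed

text \<open>Strong modules of \<open>G\<close> are strong in \<open>H\<close>, so inside
  \<open>G\<close> the strong hull of \<open>M\<close> is the whole vertex set. It differs from
  \<open>M\<close>, being strong.\<close>

lemma hull_quotient_empty:
  assumes H: "three_uniform H" and M: "hmodule H M" "M \<noteq> {}" "\<not> strong_hmodule H M"
  defines "G \<equiv> hinduce H (strong_hull H M)"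
  shows "empty_hypergraph (hquotient G (max_strong_hmodules G))"
    and "card (max_strong_hmodules G) \<ge> 3"
proof -
  define K where "K = strong_hull H M"
  have K: "strong_hmodule H K"
    unfolding K_def using strong_hmodule_strong_hull[OF H M(2) hmodule_subset[OF M(1)]] .
  then have KM: "hmodule H K"
    unfolding strong_hmodule_def by blast
  have MK: "M \<subseteq> K"
    unfolding K_def by (rule subset_strong_hull)
  have V: "hverts G = K"
    by (simp add: G_def K_def hinduce_def)
  have G: "three_uniform G"
    using three_uniform_hinduce[OF H hmodule_subset[OF KM]] by (simp add: G_def K_def)
  have MG: "hmodule G M"
    using hmodule_hinduce[OF M(1) KM MK] by (simp add: G_def K_def)
  have Mne: "M \<noteq> hverts G"
    using M(3) K V by blast
  have hull: "X = hverts G" if X: "strong_hmodule G X" "M \<subseteq> X" for X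
  proof
    have "strong_hmodule H X"
      using strong_hmodule_of_hinduce[OF K] X(1) by (simp add: G_def K_def)
    then show "hverts G \<subseteq> X"
      using strong_hull_least X(2) unfolding V K_def by blast
    show "X \<subseteq> hverts G"
      using X(1) hmodule_subset unfolding strong_hmodule_def by blast
  qed
  obtain U where U: "edge_closed G U" "U \<noteq> {}" "U \<noteq> hverts G"
    using ex_nontrivial_edge_closed[OF G MG Mne hull] by blast
  have eq: "max_strong_hmodules G = hcomp G ` hverts G"
    using max_strong_hmodules_eq_hcomp[OF G U] .
  show "empty_hypergraph (hquotient G (max_strong_hmodules G))"
    unfolding eq by (rule empty_hquotient_hcomp[OF G])
  \<comment> \<open>A component containing \<open>M\<close> would be a strong module containing
    \<open>M\<close>, hence all of \<open>G\<close>, but maximal strong modules are proper.\<close>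
  have "\<not> M \<subseteq> hcomp G v" if v: "v \<in> hverts G" for v
  proof
    assume "M \<subseteq> hcomp G v"
    then have "hcomp G v = hverts G"
      using hull[OF strong_hmodule_hcomp[OF G v]] by blast
    moreover have "hcomp G v \<in> max_strong_hmodules G"
      unfolding eq using v by blast
    ultimately show False
      unfolding max_strong_hmodules_def by blast
  qed
  then show "card (max_strong_hmodules G) \<ge> 3"
    unfolding eq by (rule card_hcomp_ge_3[OF G MG M(2) Mne])
qed

section \<open>Realizations\<close>

lemma tournament_arc_total:
  assumes "tournament T" "v \<in> pverts T" "w \<in> pverts T" "v \<noteq> w"
  shows "(v, w) \<in> parcs T \<or> (w, v) \<in> parcs T"
  using assms unfolding tournament_def by blast

lemma tournament_arcD:
  assumes "tournament T" "(v, w) \<in> parcs T"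
  shows "v \<in> pverts T" "w \<in> pverts T" "v \<noteq> w" "(w, v) \<notin> parcs T"
proof -
  interpret pair_digraph T
    using assms(1) unfolding tournament_def by blast
  show "v \<in> pverts T" "w \<in> pverts T" "v \<noteq> w"
    using in_arcsD1 in_arcsD2 no_loops' assms(2) by force+
  then show "(w, v) \<notin> parcs T"
    using assms unfolding tournament_def by blast
qed

lemma induce_subgraph_with_proj:
  "with_proj T \<restriction> X = with_proj \<lparr>pverts = X, parcs = {(u, v) \<in> parcs T. u \<in> X \<and> v \<in> X}\<rparr>"
  unfolding induce_subgraph_def with_proj_def by auto

text \<open>This removes the isomorphism from the definition, so that later arguments deal with arcs
  only.\<close>

lemma three_cycle_iff:
  "three_cycle (with_proj G) \<longleftrightarrow>
    (\<exists>a b c. distinct [a, b, c] \<and> pverts G = {a, b, c} \<and> parcs G = {(a, b), (b, c), (c, a)})"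
proof
  assume "three_cycle (with_proj G)"
  then obtain h where iso: "pre_digraph.digraph_isomorphism (with_proj G) h"
    and app: "with_proj \<lparr>pverts = {0::nat, 1, 2}, parcs = {(0, 1), (1, 2), (2, 0)}\<rparr> = app_iso h (with_proj G)"
    unfolding three_cycle_def digraph_iso_def by blast
  define f where "f = iso_verts h"
  have V: "f ` pverts G = {0, 1, 2}" and A: "iso_arcs h ` parcs G = {(0, 1), (1, 2), (2, 0)}"
    and t: "iso_tail h = fst" and hd: "iso_head h = snd"
    using app unfolding app_iso_def with_proj_def f_def by auto
  have "wf_digraph (with_proj G) \<and> inj_on f (pverts G) \<and> inj_on (iso_arcs h) (parcs G) \<and>
      (\<forall>a\<in>parcs G. f (fst a) = fst (iso_arcs h a) \<and> f (snd a) = snd (iso_arcs h a))"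
    using iso by (simp add: pre_digraph.digraph_isomorphism_def f_def t hd)
  then have inj: "inj_on f (pverts G)" and injA: "inj_on (iso_arcs h) (parcs G)"
    and ends: "\<And>a. a \<in> parcs G \<Longrightarrow> f (fst a) = fst (iso_arcs h a) \<and> f (snd a) = snd (iso_arcs h a)"
    and wf: "wf_digraph (with_proj G)"
    by blast+
  interpret pair_wf_digraph G
    using wf by (simp add: wf_digraph_wp_iff)
  \<comment> \<open>These are the preimages of 0, 1, 2 under the vertex map of the
    isomorphism.\<close>
  obtain a b c where abc: "a \<in> pverts G" "b \<in> pverts G" "c \<in> pverts G" "f a = 0" "f b = 1" "f c = 2"
  proof -
    have "0 \<in> f ` pverts G" "1 \<in> f ` pverts G" "2 \<in> f ` pverts G"
      unfolding V by simp_all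
    then show ?thesis
      using that by (elim imageE) metis
  qed
  have unique: "p = q" if "p \<in> pverts G" "q \<in> pverts G" "f p = f q" for p q
    using inj that by (auto dest: inj_onD)
  have verts: "pverts G = {a, b, c}"
  proof
    show "pverts G \<subseteq> {a, b, c}"
    proof
      fix p assume p: "p \<in> pverts G"
      have "f p \<in> {0, 1, 2}"
        unfolding V[symmetric] using p by (rule imageI)
      then have "f p = f a \<or> f p = f b \<or> f p = f c"
        using abc(4-6) by simp
      then show "p \<in> {a, b, c}"
        using unique[OF p abc(1)] unique[OF p abc(2)] unique[OF p abc(3)] by auto
    qed
  qed (use abc in auto)
  have arc: "(p, q) \<in> parcs G" if pq: "p \<in> pverts G" "q \<in> pverts G" "(f p, f q) \<in> iso_arcs h ` parcs G" for p q
  proof -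
    from pq(3) obtain e where e: "(f p, f q) = iso_arcs h e" "e \<in> parcs G"
      by (rule imageE)
    have "fst e \<in> pverts G" "snd e \<in> pverts G"
      using in_arcsD1[of "fst e" "snd e"] in_arcsD2[of "fst e" "snd e"] e(2) by simp_all
    moreover have "f (fst e) = f p" "f (snd e) = f q"
      using ends[OF e(2)] e(1)[symmetric] by simp_all
    ultimately have "fst e = p" "snd e = q"
      using unique pq(1,2) by simp_all
    then show ?thesis
      using e(2) by auto
  qed
  have dist: "distinct [a, b, c]"
    using abc(4-6) by auto
  \<comment> \<open>The arc map is a bijection onto three arcs, so three arcs found in
    \<open>G\<close> are all of its arcs.\<close>
  have "{(a, b), (b, c), (c, a)} \<subseteq> parcs G"
    using arc abc A by simp
  moreover have "card (parcs G) = card {(a, b), (b, c), (c, a)}"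
  proof -
    have "card (parcs G) = card {(0::nat, 1::nat), (1, 2), (2, 0)}"
      using card_image[OF injA] A by simp
    also have "\<dots> = card {(a, b), (b, c), (c, a)}"
      using dist by simp
    finally show ?thesis .
  qed
  moreover have "finite (parcs G)"
    using A injA by (metis finite.emptyI finite.insertI finite_imageD)
  ultimately have "parcs G = {(a, b), (b, c), (c, a)}"
    by (metis card_subset_eq)
  with dist show "\<exists>a b c. distinct [a, b, c] \<and> pverts G = {a, b, c} \<and> parcs G = {(a, b), (b, c), (c, a)}"
    using verts by blast
next
  assume "\<exists>a b c. distinct [a, b, c] \<and> pverts G = {a, b, c} \<and> parcs G = {(a, b), (b, c), (c, a)}"
  then obtain a b c where abc: "a \<noteq> b" "a \<noteq> c" "b \<noteq> c"
    and G: "pverts G = {a, b, c}" "parcs G = {(a, b), (b, c), (c, a)}"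
    by auto
  define f :: "'a \<Rightarrow> nat" where "f = (\<lambda>x. if x = a then 0 else if x = b then 1 else 2)"
  define h where "h = \<lparr>iso_verts = f, iso_arcs = map_prod f f, iso_head = snd, iso_tail = fst\<rparr>"
  have f: "f a = 0" "f b = 1" "f c = 2"
    using abc by (auto simp: f_def)
  have "wf_digraph (with_proj G)"
    by unfold_locales (auto simp: G)
  then have "pre_digraph.digraph_isomorphism (with_proj G) h"
    unfolding pre_digraph.digraph_isomorphism_def by (simp add: G f h_def abc abc[symmetric])
  moreover have "with_proj \<lparr>pverts = {0::nat, 1, 2}, parcs = {(0, 1), (1, 2), (2, 0)}\<rparr> = app_iso h (with_proj G)"
    by (simp add: app_iso_def h_def G f with_proj_def)
  ultimately show "three_cycle (with_proj G)"
    unfolding three_cycle_def digraph_iso_def by blast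
qed

lemma C3_edge_iff:
  assumes T: "tournament T"
  shows "e \<in> hedges (C3_structure T) \<longleftrightarrow>
    (\<exists>a b c. e = {a, b, c} \<and> (a, b) \<in> parcs T \<and> (b, c) \<in> parcs T \<and> (c, a) \<in> parcs T)"
proof
  assume "e \<in> hedges (C3_structure T)"
  then have "three_cycle (with_proj T \<restriction> e)"
    by (simp add: C3_structure_def)
  then obtain a b c where e: "e = {a, b, c}"
    and arcs: "{(u, v) \<in> parcs T. u \<in> e \<and> v \<in> e} = {(a, b), (b, c), (c, a)}"
    unfolding induce_subgraph_with_proj three_cycle_iff by auto
  have "{(a, b), (b, c), (c, a)} \<subseteq> parcs T"
    unfolding arcs[symmetric] by blast
  with e show "\<exists>a b c. e = {a, b, c} \<and> (a, b) \<in> parcs T \<and> (b, c) \<in> parcs T \<and> (c, a) \<in> parcs T"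
    by blast
next
  assume "\<exists>a b c. e = {a, b, c} \<and> (a, b) \<in> parcs T \<and> (b, c) \<in> parcs T \<and> (c, a) \<in> parcs T"
  then obtain a b c where e: "e = {a, b, c}"
    and arcs: "(a, b) \<in> parcs T" "(b, c) \<in> parcs T" "(c, a) \<in> parcs T"
    by blast
  note D = tournament_arcD[OF T]
  have dist: "distinct [a, b, c]"
    using D(3)[OF arcs(1)] D(3)[OF arcs(2)] D(3)[OF arcs(3)] by simp
  have "{(u, v) \<in> parcs T. u \<in> e \<and> v \<in> e} = {(a, b), (b, c), (c, a)}"
  proof -
    have "(v, v) \<notin> parcs T" for v
      using D(3) by blast
    then show ?thesis
      unfolding e using arcs D(4)[OF arcs(1)] D(4)[OF arcs(2)] D(4)[OF arcs(3)] by auto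
  qed
  then have "three_cycle (with_proj T \<restriction> e)"
    unfolding induce_subgraph_with_proj three_cycle_iff using dist e
    by (metis pair_pre_digraph.select_convs)
  moreover have "e \<subseteq> pverts T" "card e = 3"
    using D(1)[OF arcs(1)] D(1)[OF arcs(2)] D(1)[OF arcs(3)] dist e by auto
  ultimately show "e \<in> hedges (C3_structure T)"
    by (simp add: C3_structure_def)
qed

lemma tmodule_with_proj_iff:
  "tmodule (with_proj T) N \<longleftrightarrow> N \<subseteq> pverts T \<and>
    (\<forall>x\<in>N. \<forall>y\<in>N. \<forall>v\<in>pverts T. (x, v) \<in> parcs T \<and> (v, y) \<in> parcs T \<longrightarrow> v \<in> N)"
  unfolding tmodule_def by simp

text \<open>In the tournament induced on \<open>M \<union> {v}\<close> only \<open>v\<close> lies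
  outside \<open>M\<close>, so only \<open>v\<close> can violate the module condition.\<close>

lemma mem_splitters_iff:
  assumes "M \<subseteq> pverts T"
  shows "v \<in> splitters T M \<longleftrightarrow>
    v \<in> pverts T \<and> v \<notin> M \<and> (\<exists>x\<in>M. \<exists>y\<in>M. (x, v) \<in> parcs T \<and> (v, y) \<in> parcs T)"
  unfolding splitters_def induce_subgraph_with_proj tmodule_with_proj_iff by auto

text \<open>A vertex outside a tournament module has the same arc direction to all its members. A
  3-cycle crossing \<open>N\<close> thus has one vertex in \<open>N\<close>, and every member of
  \<open>N\<close> can take its place.\<close>

lemma hmodule_of_tmodule:
  assumes T: "tournament T" and N: "tmodule (with_proj T) N"
  shows "hmodule (C3_structure T) N"
proof -
  let ?H = "C3_structure T"
  note D = tournament_arcD[OF T]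
  have NV: "N \<subseteq> pverts T"
    and mod: "\<And>x y v. x \<in> N \<Longrightarrow> y \<in> N \<Longrightarrow> (x, v) \<in> parcs T \<Longrightarrow> (v, y) \<in> parcs T \<Longrightarrow> v \<in> N"
    using N D(2) unfolding tmodule_with_proj_iff by blast+
  have "\<exists>m\<in>N. e \<inter> N = {m} \<and> (\<forall>n\<in>N. (e - {m}) \<union> {n} \<in> hedges ?H)"
    if e: "e \<in> hedges ?H" "e \<inter> N \<noteq> {}" "e - N \<noteq> {}" for e
  proof -
    \<comment> \<open>The cycle is rotated so that its first vertex lies in
      \<open>N\<close>.\<close>
    obtain a b c where "e = {a, b, c}" "(a, b) \<in> parcs T" "(b, c) \<in> parcs T" "(c, a) \<in> parcs T" "a \<in> N"
      using e(1,2) unfolding C3_edge_iff[OF T] by (elim exE conjE) (auto simp: insert_commute)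
    note abc = this
    \<comment> \<open>If two vertices of the cycle were in \<open>N\<close>, the third would lie
      between them and also be in \<open>N\<close>.\<close>
    have notin: "b \<notin> N" "c \<notin> N"
      using mod abc e(3) by blast+
    have "insert n (e - {a}) \<in> hedges ?H" if n: "n \<in> N" for n
    proof -
      have "n \<in> pverts T" "n \<noteq> b" "n \<noteq> c"
        using n NV notin by blast+
      moreover have "\<not> (b, n) \<in> parcs T" "\<not> (n, c) \<in> parcs T"
        using mod[of a n b] mod[of n a c] n notin abc by blast+
      ultimately have "(n, b) \<in> parcs T" "(c, n) \<in> parcs T"
        using tournament_arc_total[OF T] D(1,2)[OF abc(3)] by blast+
      moreover have "insert n (e - {a}) = {n, b, c}"
        using abc notin by blast
      ultimately show ?thesis
        using abc(3) unfolding C3_edge_iff[OF T] by blast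
    qed
    moreover have "e \<inter> N = {a}"
      using abc notin by blast
    ultimately show ?thesis
      using abc(5) by auto
  qed
  then show ?thesis
    using NV unfolding hmodule_def by (simp add: C3_structure_def)
qed

section \<open>The nested cuts of \<open>M\<close> made by its splitters\<close>

locale realized_hmodule =
  fixes T :: "'a pair_pre_digraph" and M :: "'a set"
  assumes T: "tournament T" and M: "hmodule (C3_structure T) M"
begin

abbreviation arc :: "'a \<Rightarrow> 'a \<Rightarrow> bool" where
  "arc u v \<equiv> (u, v) \<in> parcs T"

abbreviation S :: "'a set" where
  "S \<equiv> splitters T M"

definition below :: "'a \<Rightarrow> 'a set" where
  "below s = {x \<in> M. arc x s}"

lemma M_subset: "M \<subseteq> pverts T"
  using hmodule_subset[OF M] by (simp add: C3_structure_def)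

lemmas S_iff = mem_splitters_iff[OF M_subset]

lemma arc_total: "u \<in> pverts T \<Longrightarrow> v \<in> pverts T \<Longrightarrow> u \<noteq> v \<Longrightarrow> arc u v \<or> arc v u"
  using tournament_arc_total[OF T] .

lemma arc_asym: "arc u v \<Longrightarrow> \<not> arc v u"
  using tournament_arcD(4)[OF T] .

lemma arc_irrefl: "\<not> arc u u"
  using arc_asym by blast

text \<open>Otherwise \<open>x\<close>, \<open>v\<close>, \<open>y\<close> form a 3-cycle, that is,
  an edge which leaves \<open>M\<close> but has two vertices in it.\<close>

lemma no_cycle_two_in_M:
  assumes "x \<in> M" "y \<in> M" "v \<notin> M" "arc x v" "arc v y"
  shows "arc x y"
proof (rule ccontr)
  assume "\<not> arc x y"
  moreover have "x \<noteq> y"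
    using assms arc_asym by blast
  ultimately have "arc y x"
    using arc_total assms M_subset by blast
  then have "{x, v, y} \<in> hedges (C3_structure T)"
    using assms unfolding C3_edge_iff[OF T] by blast
  moreover have "{x, v, y} \<inter> M \<noteq> {}" "\<not> {x, v, y} \<subseteq> M"
    using assms by blast+
  ultimately obtain m where "{x, v, y} \<inter> M = {m}"
    using hmoduleE[OF M] by metis
  then have "x \<in> {m}" "y \<in> {m}"
    using assms(1,2) by auto
  then show False
    using \<open>x \<noteq> y\<close> by simp
qed

text \<open>The module condition turns \<open>{y, u, v}\<close> into a 3-cycle, and the arc from
  \<open>u\<close> to \<open>v\<close> forces its orientation.\<close>

lemma cycle_replace:
  assumes "x \<in> M" "y \<in> M" "u \<notin> M" "v \<notin> M" "arc x u" "arc u v" "arc v x"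
  shows "arc y u" "arc v y"
proof -
  have "{x, u, v} \<in> hedges (C3_structure T)"
    using assms unfolding C3_edge_iff[OF T] by blast
  moreover have "{x, u, v} \<inter> M \<noteq> {}" "\<not> {x, u, v} \<subseteq> M"
    using assms by blast+
  ultimately obtain m where m: "{x, u, v} \<inter> M = {m}"
    "insert y ({x, u, v} - {m}) \<in> hedges (C3_structure T)"
    using hmoduleE[OF M] assms(2) by metis
  have "x \<in> {x, u, v} \<inter> M"
    using assms(1) by simp
  then have "m = x"
    unfolding m(1) by simp
  moreover have "{x, u, v} - {x} = {u, v}"
    using assms(1,3,4) by auto
  ultimately have "{y, u, v} \<in> hedges (C3_structure T)"
    using m(2) by simp
  then obtain a b c where abc: "{y, u, v} = {a, b, c}" "arc a b" "arc b c" "arc c a"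
    unfolding C3_edge_iff[OF T] by auto
  have "a \<in> {y, u, v}" "b \<in> {y, u, v}" "c \<in> {y, u, v}"
    unfolding abc(1) by simp_all
  then show "arc y u" "arc v y"
    using abc(2-4) arc_asym arc_asym[OF assms(6)] arc_irrefl by auto
qed

lemma below_ne:
  assumes "s \<in> S"
  shows "below s \<noteq> {}" "\<not> M \<subseteq> below s"
  using assms arc_asym unfolding S_iff below_def by blast+

lemma arc_to_above:
  assumes "s \<in> S" "y \<in> M" "y \<notin> below s"
  shows "arc s y"
  using assms arc_total M_subset unfolding S_iff below_def by blast

lemma arc_below_above:
  assumes "s \<in> S" "x \<in> below s" "y \<in> M" "y \<notin> below s"
  shows "arc x y"
  using no_cycle_two_in_M[of x y s] arc_to_above assms unfolding S_iff below_def by blast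

text \<open>For incomparable cuts, \<open>x\<close> and \<open>y\<close> in the two differences
  would be joined by arcs in both directions.\<close>

lemma below_chain:
  assumes "s \<in> S" "t \<in> S"
  shows "below s \<subseteq> below t \<or> below t \<subseteq> below s"
proof (rule ccontr)
  assume "\<not> ?thesis"
  then obtain x y where "x \<in> below s" "x \<notin> below t" "y \<in> below t" "y \<notin> below s"
    by blast
  then show False
    using arc_below_above[OF assms(1), of x y] arc_below_above[OF assms(2), of y x] arc_asym
    unfolding below_def by blast
qed

text \<open>If \<open>t\<close> dominated \<open>s\<close>, a vertex \<open>y\<close> between the
  two cuts would give the 3-cycle \<open>y\<close>, \<open>t\<close>, \<open>s\<close>. Replacing
  \<open>y\<close> by some \<open>x\<close> in \<open>below s\<close> would yield an arc from
  \<open>s\<close> to \<open>x\<close>.\<close>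

lemma arc_of_below_psubset:
  assumes s: "s \<in> S" and t: "t \<in> S" and less: "below s \<subset> below t"
  shows "arc s t"
proof (rule ccontr)
  assume no: "\<not> arc s t"
  obtain y where y: "y \<in> below t" "y \<notin> below s"
    using less by blast
  obtain x where x: "x \<in> below s"
    using below_ne[OF s] by blast
  have "s \<noteq> t"
    using less by blast
  then have ts: "arc t s"
    using arc_total no s t unfolding S_iff by blast
  have "arc y t" "arc s y" "y \<in> M" "x \<in> M" "arc x s"
    using y x arc_to_above[OF s] unfolding below_def by blast+
  then have "arc s x"
    using cycle_replace(2)[of y x t s] ts s t unfolding S_iff by blast
  then show False
    using arc_asym \<open>arc x s\<close> by blast
qed

section \<open>Vertices outside \<open>M\<close> and its splitters\<close>

lemma outside_const_on_M:
  assumes w: "w \<in> pverts T" "w \<notin> M" "w \<notin> S" and pq: "p \<in> M" "q \<in> M" "arc w p"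
  shows "arc w q"
proof (rule ccontr)
  assume "\<not> arc w q"
  moreover have "q \<in> pverts T" "w \<noteq> q"
    using pq(2) M_subset w(2) by blast+
  ultimately have "arc q w"
    using arc_total w(1) by blast
  then have "w \<in> S"
    unfolding S_iff using w(1,2) pq by blast
  then show False
    using w(3) by simp
qed

text \<open>Let \<open>a\<close> and \<open>b\<close> lie on the two sides of the cut at
  \<open>s\<close>. If \<open>w\<close> dominates \<open>M\<close> and \<open>s\<close> dominates
  \<open>w\<close>, replacing \<open>a\<close> by \<open>b\<close> in the 3-cycle \<open>a\<close>,
  \<open>s\<close>, \<open>w\<close> reverses the arc from \<open>s\<close> to \<open>b\<close>. The
  opposite case replaces \<open>b\<close> by \<open>a\<close> in the 3-cycle \<open>b\<close>,
  \<open>w\<close>, \<open>s\<close>.\<close>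

lemma outside_uniform:
  assumes s: "s \<in> S" and w: "w \<in> pverts T" "w \<notin> M" "w \<notin> S" and x: "x \<in> M"
  shows "arc w x \<longleftrightarrow> arc w s"
proof -
  note M_const = outside_const_on_M[OF w]
  obtain a b where ab: "a \<in> M" "b \<in> M" "arc a s" "arc s b"
    using s unfolding S_iff by blast
  have sM: "s \<notin> M" "s \<in> pverts T" "s \<noteq> w"
    using s w unfolding S_iff by blast+
  have "arc w s" if wx: "arc w x"
  proof (rule ccontr)
    assume "\<not> arc w s"
    then have "arc s w"
      using arc_total sM w by blast
    moreover have "arc w a" "arc w b"
      using M_const[OF x _ wx] ab by simp_all
    ultimately have "arc b s"
      using cycle_replace(1)[of a b s w] ab sM(1) w(2) by simp
    then show False
      using ab arc_asym by blast
  qed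
  moreover have "arc w x" if ws: "arc w s"
  proof (rule ccontr)
    assume "\<not> arc w x"
    then have "\<not> arc w a" "\<not> arc w b"
      using M_const[OF _ x] ab by blast+
    moreover have "a \<in> pverts T" "b \<in> pverts T" "a \<noteq> w" "b \<noteq> w"
      using ab(1,2) M_subset w(2) by blast+
    ultimately have "arc a w" "arc b w"
      using arc_total w(1) by blast+
    then have "arc s a"
      using cycle_replace(2)[of b a w s] ws ab sM(1) w(2) by simp
    then show False
      using ab arc_asym by blast
  qed
  ultimately show "arc w x \<longleftrightarrow> arc w s"
    by blast
qed

lemma outside_const:
  assumes w: "w \<in> pverts T" "w \<notin> M \<union> S" and uv: "u \<in> M \<union> S" "v \<in> M \<union> S"
  shows "arc w u \<Longrightarrow> arc w v"
proof -
  have M_const: "arc w q" if "p \<in> M" "q \<in> M" "arc w p" for p q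
    using outside_const_on_M[of w p q] that w by simp
  have S_const: "arc w s \<longleftrightarrow> arc w x" if "s \<in> S" "x \<in> M" for s x
    using outside_uniform[of s w x] that w by blast
  obtain x where x: "x \<in> M"
    using uv(1) by (auto simp: S_iff)
  have "arc w x" if "arc w u"
    using that uv(1) S_const[OF _ x] M_const[OF _ x] by blast
  moreover have "arc w v" if "arc w x"
    using that uv(2) S_const[OF _ x] M_const[OF x] by blast
  ultimately show "arc w u \<Longrightarrow> arc w v"
    by blast
qed

lemma tmodule_M_Un_S: "tmodule (with_proj T) (M \<union> S)"
  unfolding tmodule_with_proj_iff
proof (intro conjI ballI impI)
  show "M \<union> S \<subseteq> pverts T"
    using M_subset by (auto simp: S_iff)
next
  fix x y v assume xyv: "x \<in> M \<union> S" "y \<in> M \<union> S" "v \<in> pverts T" "arc x v \<and> arc v y"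
  show "v \<in> M \<union> S"
  proof (rule ccontr)
    assume "v \<notin> M \<union> S"
    then have "arc v x"
      using outside_const[OF xyv(3) _ xyv(2,1)] xyv(4) by simp
    then show False
      using arc_asym xyv(4) by blast
  qed
qed

text \<open>Splitters with the same cut as \<open>s\<close> are all included, since the arcs among
  them are not determined by their cuts.\<close>

definition segment :: "'a \<Rightarrow> 'a set" where
  "segment s = below s \<union> {u \<in> S. below u \<subseteq> below s}"

lemma arc_segment:
  assumes s: "s \<in> S" and u: "u \<in> segment s" and v: "v \<in> M \<union> S" "v \<notin> segment s"
  shows "arc u v"
proof -
  have "v \<notin> below s" "v \<in> S \<longrightarrow> \<not> below v \<subseteq> below s"
    using v(2) by (simp_all add: segment_def)
  \<comment> \<open>Comparability of the cuts turns a failed inclusion into a strict reverse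
    inclusion.\<close>
  then have v_cases: "v \<in> M \<and> v \<notin> below s \<or> v \<in> S \<and> below s \<subset> below v"
    using v(1) below_chain[OF s, of v] by blast
  have "u \<in> below s \<or> u \<in> S \<and> below u \<subseteq> below s"
    using u by (simp add: segment_def)
  then show ?thesis
  proof
    assume u: "u \<in> below s"
    show ?thesis
      using v_cases
    proof
      assume "v \<in> M \<and> v \<notin> below s"
      then show ?thesis
        using arc_below_above[OF s u] by simp
    next
      assume "v \<in> S \<and> below s \<subset> below v"
      then have "u \<in> below v"
        using u by blast
      then show ?thesis
        by (simp add: below_def)
    qed
  next
    assume u: "u \<in> S \<and> below u \<subseteq> below s"
    show ?thesis
      using v_cases
    proof
      assume "v \<in> M \<and> v \<notin> below s"
      then show ?thesis
        using arc_to_above[of u v] u by blast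
    next
      assume "v \<in> S \<and> below s \<subset> below v"
      then show ?thesis
        using arc_of_below_psubset[of u v] u by blast
    qed
  qed
qed

text \<open>No outside vertex lies between members of the segment: the rest of
  \<open>M \<union> S\<close> is dominated by it, and \<open>M \<union> S\<close> is itself a
  module.\<close>

lemma tmodule_segment:
  assumes s: "s \<in> S"
  shows "tmodule (with_proj T) (segment s)"
proof -
  have sub: "segment s \<subseteq> M \<union> S"
    by (auto simp: segment_def below_def)
  show ?thesis
    unfolding tmodule_with_proj_iff
  proof (intro conjI ballI impI)
    show "segment s \<subseteq> pverts T"
      using sub tmodule_M_Un_S unfolding tmodule_with_proj_iff by (meson subset_trans)
  next
    fix x y v
    assume xyv: "x \<in> segment s" "y \<in> segment s" "v \<in> pverts T" "arc x v \<and> arc v y"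
    then have "v \<in> M \<union> S"
      using tmodule_M_Un_S sub unfolding tmodule_with_proj_iff by (meson subsetD)
    then show "v \<in> segment s"
      using arc_segment[OF s xyv(2)] arc_asym xyv(4) by metis
  qed
qed

lemma hmodule_segment: "s \<in> S \<Longrightarrow> hmodule (C3_structure T) (segment s)"
  using hmodule_of_tmodule[OF T tmodule_segment] .

section \<open>Splitters and strong modules containing \<open>M\<close>\<close>

lemma S_ne:
  assumes "\<not> tmodule (with_proj T) M"
  shows "S \<noteq> {}"
  using assms M_subset S_iff unfolding tmodule_with_proj_iff by blast

text \<open>The module \<open>segment s\<close> meets \<open>M\<close> but misses \<open>b\<close>
  in \<open>M\<close>, so a strong module containing \<open>M\<close> is not inside the segment and
  must contain it.\<close>

lemma splitter_in_strong:
  assumes s: "s \<in> S" and N: "strong_hmodule (C3_structure T) N" "M \<subseteq> N"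
  shows "s \<in> N"
proof -
  obtain a b where a: "a \<in> below s" and b: "b \<in> M" "b \<notin> below s"
    using below_ne[OF s] by blast
  have "a \<in> N" "a \<in> segment s" "b \<in> N" "b \<notin> segment s"
    using a b N(2) by (auto simp: segment_def below_def S_iff)
  then have "segment s \<subseteq> N"
    using strong_hmoduleD(2)[OF N(1) hmodule_segment[OF s]] by blast
  moreover have "s \<in> segment s"
    using s by (simp add: segment_def)
  ultimately show ?thesis
    by blast
qed

end

theorem proposition46:
  fixes H :: "'a hypergraph" and T :: "'a pair_pre_digraph" and M :: "'a set"
  assumes "three_uniform H" and "realizable H"
    and "realization T H"
    and "hmodule H M"
    and "\<not> tmodule (with_proj T) M"
  shows "tmodule (with_proj T) (M \<union> splitters T M)
    \<and> \<not> strong_hmodule H M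
    \<and> M \<union> splitters T M \<subseteq> strong_hull H M
    \<and> empty_hypergraph
         (hquotient (hinduce H (strong_hull H M))
            (max_strong_hmodules (hinduce H (strong_hull H M))))
    \<and> card (max_strong_hmodules (hinduce H (strong_hull H M))) \<ge> 3"
proof -
  have H: "H = C3_structure T" and T: "tournament T"
    using assms(3) unfolding realization_def by auto
  interpret realized_hmodule T M
    using T assms(4) H by unfold_locales auto
  obtain s where s: "s \<in> splitters T M"
    using S_ne[OF assms(5)] by blast
  then have "s \<notin> M" "M \<noteq> {}"
    unfolding S_iff by blast+
  \<comment> \<open>Taking \<open>N\<close> to be \<open>M\<close> itself would put the splitter
    \<open>s\<close> into \<open>M\<close>.\<close>
  then have not_strong: "\<not> strong_hmodule H M"
    using splitter_in_strong[OF s] H by blast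
  have "splitters T M \<subseteq> strong_hull H M"
    using splitter_in_strong unfolding strong_hull_def H by blast
  then show ?thesis
    using tmodule_M_Un_S not_strong subset_strong_hull[of M H]
      hull_quotient_empty[OF assms(1,4) \<open>M \<noteq> {}\<close> not_strong] by blast
qed

end
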